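(* There is an absolute constant $c>0$ such that for every $n\ge 2$ there is a set $P\subset[0,1]^2$ of $n$ points in general position that avoids $231$ and satisfies $\mathrm{TSP}(P)\ge c\log n$.
   Context: A finite point set is in general position if no two points share an $x$- or $y$-coordinate. Such a set corresponds to the permutation obtained by listing its points by increasing $x$-coordinate and recording the ranks of their $y$-coordinates; it avoids $231$ if this permutation has no subsequence $a,b,c$ with $c<a<b$. $\mathrm{TSP}(P)$ denotes the minimum Euclidean length of a closed tour visiting all points of $P$. *)

theory Defs
  imports
    "HOL-Analysis.Analysis"
    "HOL-Library.Sublist"
    "HOL-Combinatorics.Multiset_Permutations"
begin

text \<open>
  Points of the plane are elements of \<^typ>\<open>real \<times> real\<close>, on which \<^const>\<open>dist\<close> is the
  Euclidean distance.
\<close>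

definition general_position :: "(real \<times> real) set \<Rightarrow> bool" where
  "general_position P \<longleftrightarrow> finite P \<and> inj_on fst P \<and> inj_on snd P"

text \<open>Ranks are counted from 1.\<close>

definition y_rank :: "(real \<times> real) set \<Rightarrow> real \<times> real \<Rightarrow> nat" where
  "y_rank P p = card {q \<in> P. snd q \<le> snd p}"

text \<open>
  The permutation in one-line notation. Like \<^const>\<open>sorted_key_list_of_set\<close>, it is only
  meaningful for a finite set on which \<^const>\<open>fst\<close> is injective.
\<close>

definition point_perm :: "(real \<times> real) set \<Rightarrow> nat list" where
  "point_perm P = map (y_rank P) (sorted_key_list_of_set fst P)"

definition avoids_231 :: "nat list \<Rightarrow> bool" where
  "avoids_231 w \<longleftrightarrow> (\<nexists>a b c. subseq [a, b, c] w \<and> c < a \<and> a < b)"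

text \<open>The summand for the last index is the edge back to the first point.\<close>

definition closed_tour_length :: "(real \<times> real) list \<Rightarrow> real" where
  "closed_tour_length xs =
     (\<Sum>i<length xs. dist (xs ! i) (xs ! (Suc i mod length xs)))"

text \<open>
  A tour visits every point once; by the triangle inequality, allowing repeated visits would
  not change the minimum. The set of tours is finite and, for finite \<open>P\<close>, nonempty.
\<close>

definition TSP :: "(real \<times> real) set \<Rightarrow> real" where
  "TSP P = Min (closed_tour_length ` permutations_of_set P)"

end

theory Submission
  imports Defs
begin

text \<open>
  A point \<open>(a, b)\<close> with \<open>a < b\<close> is read as the interval \<open>[a, b]\<close>. An occurrence of 231 contains two
  crossing intervals, so a laminar family avoids 231. If moreover nested intervals shrink by a
  factor 2, then the distance of two points is at least a constant times the sum of the lengths of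
  their intervals, and hence the length of a tour is at least a constant times the total length of
  all intervals. The dyadic intervals of length at least \<open>1 / n\<close>, perturbed so that their endpoints
  become distinct, have total length of order \<open>log n\<close>.
\<close>

section \<open>Intervals that are disjoint or nested with halving\<close>

definition len :: "real \<times> real \<Rightarrow> real" where
  "len p = snd p - fst p"

definition half_inside :: "real \<times> real \<Rightarrow> real \<times> real \<Rightarrow> bool" where
  "half_inside p q \<longleftrightarrow> fst q < fst p \<and> snd p < snd q \<and> 2 * len p \<le> len q"

text \<open>All comparisons are strict, so that compatible intervals share neither their left nor
  their right endpoints. This is what yields general position.\<close>

definition compatible :: "real \<times> real \<Rightarrow> real \<times> real \<Rightarrow> bool" where
  "compatible p q \<longleftrightarrow> snd p < fst q \<or> snd q < fst p \<or> half_inside p q \<or> half_inside q p"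

definition halving_laminar :: "(real \<times> real) set \<Rightarrow> bool" where
  "halving_laminar P \<longleftrightarrow> finite P \<and> (\<forall>p\<in>P. fst p < snd p) \<and> pairwise compatible P"

lemma halving_laminar_compatible:
  "halving_laminar P \<Longrightarrow> p \<in> P \<Longrightarrow> q \<in> P \<Longrightarrow> p \<noteq> q \<Longrightarrow> compatible p q"
  by (auto simp: halving_laminar_def pairwise_def)

lemma halving_laminar_less: "halving_laminar P \<Longrightarrow> p \<in> P \<Longrightarrow> fst p < snd p"
  by (auto simp: halving_laminar_def)

lemma halving_laminar_general_position:
  assumes "halving_laminar P"
  shows "general_position P"
proof -
  have "fst p \<noteq> fst q \<and> snd p \<noteq> snd q" if "p \<in> P" "q \<in> P" "p \<noteq> q" for p q
    using halving_laminar_compatible[OF assms that]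
      halving_laminar_less[OF assms that(1)] halving_laminar_less[OF assms that(2)]
    by (auto simp: compatible_def half_inside_def)
  then show ?thesis
    using assms unfolding general_position_def halving_laminar_def inj_on_def by blast
qed

section \<open>Avoidance of 231\<close>

lemma y_rank_mono:
  assumes "finite P" "snd p \<le> snd q"
  shows "y_rank P p \<le> y_rank P q"
  unfolding y_rank_def using assms by (intro card_mono) auto

lemma sorted_wrt_subseq:
  assumes "subseq xs ys" "sorted_wrt R ys"
  shows "sorted_wrt R xs"
  using assms
proof (induction rule: list_emb.induct)
  case (list_emb_Cons2 x y xs ys)
  then show ?case
    by (auto simp: subseq_conv_nths dest: in_set_nthsD)
qed auto

text \<open>\<open>folding_insort_key\<close> asks for a key that is injective on a fixed carrier.
  Taking \<open>A\<close> itself as the carrier makes injectivity on \<open>A\<close>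
  enough.\<close>

lemma (in linorder) sorted_key_list_of_set_inj_on:
  assumes "inj_on f A"
  shows "sorted_wrt (<) (map f (sorted_key_list_of_set f A))"
    and "finite A \<Longrightarrow> set (sorted_key_list_of_set f A) = A"
proof -
  interpret key: folding_insort_key "(\<le>)" "(<)" A f
    using assms by unfold_locales
  show "sorted_wrt (<) (map f (sorted_key_list_of_set f A))"
    by (rule key.strict_sorted_key_list_of_set) simp
  show "finite A \<Longrightarrow> set (sorted_key_list_of_set f A) = A"
    by (rule key.set_sorted_key_list_of_set) simp_all
qed

lemma not_avoids_231_point_permE:
  assumes "general_position P" "\<not> avoids_231 (point_perm P)"
  obtains p q r where "p \<in> P" "q \<in> P" "r \<in> P" "fst p < fst q" "fst q < fst r"
    "snd r < snd p" "snd p < snd q"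
proof -
  let ?xs = "sorted_key_list_of_set fst P"
  have fin: "finite P" and inj: "inj_on fst P"
    using assms(1) by (auto simp: general_position_def)
  obtain a b c where abc: "subseq [a, b, c] (map (y_rank P) ?xs)" "c < a" "a < b"
    using assms(2) by (auto simp: avoids_231_def point_perm_def)
  \<comment> \<open>The subsequence of ranks is pulled back along \<open>map\<close> to a
    subsequence of points, which is still sorted by x-coordinate.\<close>
  then obtain N where "[a, b, c] = map (y_rank P) (nths ?xs N)"
    by (metis subseq_conv_nths nths_map)
  then obtain ys where ys: "subseq ys ?xs" "[a, b, c] = map (y_rank P) ys"
    by (metis subseq_conv_nths)
  then obtain p q r where pqr: "ys = [p, q, r]" "y_rank P p = a" "y_rank P q = b" "y_rank P r = c"
    by (auto simp: Cons_eq_map_conv)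
  have "subseq (map fst ys) (map fst ?xs)"
    using ys(1) by (rule subseq_map)
  moreover have "sorted_wrt (<) (map fst ?xs)"
    by (rule sorted_key_list_of_set_inj_on[OF inj])
  ultimately have "sorted_wrt (<) (map fst ys)"
    by (rule sorted_wrt_subseq)
  moreover have "set ys \<subseteq> P"
    using ys(1) sorted_key_list_of_set_inj_on(2)[OF inj fin]
    by (auto dest: in_set_nthsD simp: subseq_conv_nths)
  ultimately have "p \<in> P" "q \<in> P" "r \<in> P" "fst p < fst q" "fst q < fst r"
    by (auto simp: pqr(1))
  \<comment> \<open>The contrapositive of \<open>y_rank_mono\<close>: a strictly smaller rank forces
    a strictly smaller y-coordinate.\<close>
  moreover have "snd r < snd p" "snd p < snd q"
    using abc(2,3) y_rank_mono[OF fin] pqr(2-4) by (meson not_less)+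
  ultimately show ?thesis
    by (rule that)
qed

lemma halving_laminar_avoids_231:
  assumes "halving_laminar P"
  shows "avoids_231 (point_perm P)"
proof (rule ccontr)
  assume "\<not> avoids_231 (point_perm P)"
  with halving_laminar_general_position[OF assms]
  obtain p q r where "p \<in> P" "q \<in> P" "r \<in> P" "fst p < fst q" "fst q < fst r"
    "snd r < snd p" "snd p < snd q"
    by (rule not_avoids_231_point_permE)
  \<comment> \<open>Since \<open>r\<close> is an interval,
    \<open>fst q < fst r < snd r < snd p\<close>. Hence \<open>p\<close> and \<open>q\<close>
    overlap although neither contains the other.\<close>
  then show False
    using halving_laminar_compatible[OF assms, of p q] halving_laminar_less[OF assms]
    by (fastforce simp: compatible_def half_inside_def)
qed

section \<open>Lower bound for tours\<close>

lemma compatible_dist: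
  assumes "compatible p q" "fst p < snd p" "fst q < snd q"
  shows "(len p + len q) / 8 \<le> dist p q"
proof -
  have d: "fst p - fst q \<le> dist p q" "fst q - fst p \<le> dist p q"
    "snd p - snd q \<le> dist p q" "snd q - snd p \<le> dist p q"
    using dist_fst_le[of p q] dist_snd_le[of p q] by (auto simp: dist_real_def)
  from assms(1) consider "snd p < fst q" | "snd q < fst p"
    | "fst q < fst p" "snd p < snd q" "2 * len p \<le> len q"
    | "fst p < fst q" "snd q < snd p" "2 * len q \<le> len p"
    by (auto simp: compatible_def half_inside_def)
  \<comment> \<open>For disjoint intervals the left endpoints or the right endpoints are at least
    the larger length apart. If \<open>p\<close> lies inside \<open>q\<close>, the two endpoint gaps
    add up to \<open>len q - len p\<close>, which is at least \<open>len q / 2\<close>; so one gap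
    is at least \<open>len q / 4\<close>, and \<open>len p \<le> len q\<close>.\<close>
  then show ?thesis
    using d assms(2,3) by cases (simp_all add: len_def)
qed

lemma sum_nth_Suc_mod:
  fixes f :: "'a \<Rightarrow> 'b::comm_monoid_add"
  shows "(\<Sum>i<length xs. f (xs ! (Suc i mod length xs))) = (\<Sum>i<length xs. f (xs ! i))"
proof -
  have "(\<Sum>i<length xs. f (xs ! (Suc i mod length xs))) = sum_list (map f (rotate1 xs))"
    by (simp add: sum_list_sum_nth atLeast0LessThan nth_rotate1)
  also have "\<dots> = sum_list (map f xs)"
    by (cases xs) (auto simp: add.commute)
  finally show ?thesis
    by (simp add: sum_list_sum_nth atLeast0LessThan)
qed

text \<open>Each point is an end of two edges of the cyclic sum, so the factor 1/8 per edge becomes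
  1/4 per point.\<close>

lemma closed_tour_length_ge:
  assumes P: "halving_laminar P" "2 \<le> card P" and xs: "xs \<in> permutations_of_set P"
  shows "(\<Sum>p\<in>P. len p) / 4 \<le> closed_tour_length xs"
proof -
  have set: "set xs = P" and distinct: "distinct xs"
    using xs by (auto simp: permutations_of_set_def)
  then have n: "length xs = card P"
    by (metis distinct_card)
  have sum: "(\<Sum>i<length xs. len (xs ! i)) = (\<Sum>p\<in>P. len p)"
    using sum_list_distinct_conv_sum_set[OF distinct, of len]
    by (simp add: set sum_list_sum_nth atLeast0LessThan)
  have edge: "(len (xs ! i) + len (xs ! (Suc i mod length xs))) / 8
      \<le> dist (xs ! i) (xs ! (Suc i mod length xs))" if i: "i < length xs" for i
  proof -
    have lt: "Suc i mod length xs < length xs"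
      using i by (intro mod_less_divisor) auto
    \<comment> \<open>With at least two points no edge is a loop, so the two ends are distinct and
      therefore compatible.\<close>
    moreover have "Suc i mod length xs \<noteq> i"
      using i P(2) n by (cases "Suc i = length xs") auto
    ultimately have "xs ! i \<noteq> xs ! (Suc i mod length xs)"
      using i distinct by (metis nth_eq_iff_index_eq)
    moreover have "xs ! i \<in> P" "xs ! (Suc i mod length xs) \<in> P"
      using i lt set by (metis nth_mem)+
    ultimately show ?thesis
      using P(1) by (intro compatible_dist halving_laminar_compatible halving_laminar_less)
  qed
  have "(\<Sum>p\<in>P. len p) / 4 =
      (\<Sum>i<length xs. (len (xs ! i) + len (xs ! (Suc i mod length xs))) / 8)"
    by (simp add: sum_nth_Suc_mod sum sum.distrib flip: sum_divide_distrib)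
  also have "\<dots> \<le> closed_tour_length xs"
    unfolding closed_tour_length_def by (intro sum_mono edge) simp
  finally show ?thesis .
qed

lemma TSP_ge:
  assumes "halving_laminar P" "2 \<le> card P"
  shows "(\<Sum>p\<in>P. len p) / 4 \<le> TSP P"
  unfolding TSP_def using assms closed_tour_length_ge[OF assms]
  by (subst Min_ge_iff) (auto simp: halving_laminar_def)

section \<open>Recursive construction of long families\<close>

definition shrink :: "real \<Rightarrow> real \<Rightarrow> real \<times> real \<Rightarrow> real \<times> real" where
  "shrink t s p = (t + s * fst p, t + s * snd p)"

lemma shrink_simps [simp]:
  "fst (shrink t s p) = t + s * fst p" "snd (shrink t s p) = t + s * snd p"
  "len (shrink t s p) = s * len p"
  by (simp_all add: shrink_def len_def algebra_simps)

lemma inj_shrink: "s > 0 \<Longrightarrow> inj (shrink t s)"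
  by (auto simp: inj_def shrink_def prod_eq_iff)

text \<open>One increasing affine map of the line acts on both endpoints, so it keeps their order
  and the ratios of lengths.\<close>

lemma compatible_shrink: "s > 0 \<Longrightarrow> compatible p q \<Longrightarrow> compatible (shrink t s p) (shrink t s q)"
  by (auto simp: compatible_def half_inside_def mult.left_commute[of 2 s])

lemma halving_laminar_shrink:
  assumes "s > 0" "halving_laminar P"
  shows "halving_laminar (shrink t s ` P)"
  using assms unfolding halving_laminar_def pairwise_def
  by (auto intro!: compatible_shrink simp del: split_paired_All)

text \<open>Copies of \<open>P\<close> and \<open>Q\<close>, scaled by \<open>l / 2\<close>, are
  centred in the two halves of the unit interval, and the unit interval itself is added. As
  \<open>l < 1\<close>, each copy keeps a margin of \<open>(1 - l) / 4\<close> on both sides, which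
  makes all the comparisons strict.\<close>

lemma halving_laminar_insert_union:
  assumes P: "halving_laminar P" "P \<subseteq> {0..1} \<times> {0..1}"
    and Q: "halving_laminar Q" "Q \<subseteq> {0..1} \<times> {0..1}"
    and l: "0 < l" "l < 1"
  obtains R where "halving_laminar R" "R \<subseteq> {0..1} \<times> {0..1}"
    "card R = Suc (card P + card Q)"
    "(\<Sum>p\<in>R. len p) = 1 + l / 2 * ((\<Sum>p\<in>P. len p) + (\<Sum>p\<in>Q. len p))"
proof -
  define A where "A = shrink ((1 - l) / 4) (l / 2) ` P"
  define B where "B = shrink (1 / 2 + (1 - l) / 4) (l / 2) ` Q"
  \<comment> \<open>Both copies at once: \<open>t\<close> is the left end of the half, 0 or
    1/2.\<close>
  have box: "t < fst p \<and> t < snd p \<and> fst p < t + 1 / 2 \<and> snd p < t + 1 / 2 \<and> 2 * len p \<le> 1"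
    if p: "p \<in> shrink (t + (1 - l) / 4) (l / 2) ` S" and S: "S \<subseteq> {0..1} \<times> {0..1}" for p t S
  proof -
    obtain q where q: "q \<in> S" "p = shrink (t + (1 - l) / 4) (l / 2) q"
      using p by blast
    define x y where "x = l / 2 * fst q" and "y = l / 2 * snd q"
    have "0 \<le> fst q" "fst q \<le> 1" "0 \<le> snd q" "snd q \<le> 1"
      using q(1) S by auto
    then have "0 \<le> x" "x \<le> l / 2" "0 \<le> y" "y \<le> l / 2"
      using l unfolding x_def y_def by (auto simp: mult_le_cancel_left1)
    moreover have "fst p = t + (1 - l) / 4 + x" "snd p = t + (1 - l) / 4 + y"
      by (simp_all add: q(2) x_def y_def)
    ultimately show ?thesis
      using l unfolding len_def by (simp add: field_simps)
  qed
  have in_A: "0 < fst p \<and> 0 < snd p \<and> fst p < 1 / 2 \<and> snd p < 1 / 2 \<and> 2 * len p \<le> 1"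
    if "p \<in> A" for p
    using box[of p 0 P] that P(2) by (simp add: A_def)
  have in_B: "1 / 2 < fst p \<and> 1 / 2 < snd p \<and> fst p < 1 \<and> snd p < 1 \<and> 2 * len p \<le> 1"
    if "p \<in> B" for p
    using box[of p "1 / 2" Q] that Q(2) unfolding B_def by simp
  have AB: "halving_laminar A" "halving_laminar B"
    unfolding A_def B_def using l P(1) Q(1) by (auto intro!: halving_laminar_shrink)
  then have fin: "finite A" "finite B"
    by (auto simp: halving_laminar_def)
  have disj: "A \<inter> B = {}" "(0, 1) \<notin> A \<union> B"
    using in_A in_B by fastforce+
  have card: "card A = card P" "card B = card Q"
    unfolding A_def B_def using l by (auto intro!: card_image inj_on_subset[OF inj_shrink])
  have sum: "(\<Sum>p\<in>A. len p) = l / 2 * (\<Sum>p\<in>P. len p)"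
    "(\<Sum>p\<in>B. len p) = l / 2 * (\<Sum>p\<in>Q. len p)"
    unfolding A_def B_def using l
    by (subst sum.reindex; auto intro!: inj_on_subset[OF inj_shrink] simp: sum_distrib_left)+
  show ?thesis
  proof
    have "compatible p q \<and> compatible q p" if "p \<in> A" "q \<in> B" for p q
      using in_A[OF that(1)] in_B[OF that(2)] by (auto simp: compatible_def)
    moreover have "compatible (0, 1) p \<and> compatible p (0, 1)" if "p \<in> A \<union> B" for p
      using in_A[of p] in_B[of p] that by (auto simp: compatible_def half_inside_def len_def)
    ultimately show "halving_laminar (insert (0, 1) (A \<union> B))"
      using AB by (auto simp: halving_laminar_def pairwise_insert pairwise_def)
    show "insert (0, 1) (A \<union> B) \<subseteq> {0..1} \<times> {0..1}"
      using in_A in_B by fastforce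
    show "card (insert (0, 1) (A \<union> B)) = Suc (card P + card Q)"
      using fin disj by (simp add: card_Un_disjoint card)
    show "(\<Sum>p\<in>insert (0, 1) (A \<union> B). len p) =
        1 + l / 2 * ((\<Sum>p\<in>P. len p) + (\<Sum>p\<in>Q. len p))"
      using fin disj by (simp add: sum.union_disjoint sum len_def[of "(0, 1)"] algebra_simps)
  qed
qed

lemma sum_len_nonneg: "halving_laminar P \<Longrightarrow> 0 \<le> (\<Sum>p\<in>P. len p)"
  by (intro sum_nonneg) (auto simp: len_def halving_laminar_def less_imp_le)

text \<open>The hypothesis says that a full binary tree with \<open>k\<close> levels, which has
  \<open>2 ^ k - 1\<close> nodes, fits into \<open>n\<close> points.\<close>

lemma halving_laminar_exists:
  assumes "2 ^ k \<le> Suc n"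
  shows "\<exists>P \<subseteq> {0..1} \<times> {0..1}. halving_laminar P \<and> card P = n \<and> real k / 2 \<le> (\<Sum>p\<in>P. len p)"
  using assms
proof (induction k arbitrary: n)
  case 0
  show ?case
  proof (induction n)
    case 0
    show ?case
      by (rule exI[of _ "{}"]) (simp add: halving_laminar_def)
  next
    case (Suc n)
    then obtain P where P: "halving_laminar P" "P \<subseteq> {0..1} \<times> {0..1}" "card P = n"
      by auto
    \<comment> \<open>For \<open>k = 0\<close> only the cardinality matters: points are added one by
      one, with an arbitrary scaling factor.\<close>
    have "halving_laminar {}"
      by (simp add: halving_laminar_def)
    then obtain R where "halving_laminar R" "R \<subseteq> {0..1} \<times> {0..1}" "card R = Suc n"
      using halving_laminar_insert_union[OF P(1,2), of "{}" "1 / 2"] P(3) by auto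
    then show ?case
      using sum_len_nonneg by auto
  qed
next
  case (Suc k)
  \<comment> \<open>The left half receives exactly a full tree with \<open>k\<close> levels. The
    right half receives the remaining points, which are at least as many.\<close>
  define m where "m = 2 ^ k - (1::nat)"
  have "Suc m = 2 ^ k"
    by (simp add: m_def)
  then have m: "2 ^ k \<le> Suc m" "2 ^ k \<le> Suc (n - 1 - m)" "n = Suc (m + (n - 1 - m))"
    using Suc.prems by auto
  obtain P Q where P: "halving_laminar P" "P \<subseteq> {0..1} \<times> {0..1}" "card P = m"
      "real k / 2 \<le> (\<Sum>p\<in>P. len p)"
    and Q: "halving_laminar Q" "Q \<subseteq> {0..1} \<times> {0..1}" "card Q = n - 1 - m"
      "real k / 2 \<le> (\<Sum>p\<in>Q. len p)"
    using Suc.IH[OF m(1)] Suc.IH[OF m(2)] by blast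
  \<comment> \<open>The factors telescope: starting from level \<open>K\<close>, the intervals at depth \<open>d\<close> are
    shrunk by \<open>(K + 1 - d) / (K + 1)\<close> in total, which is about \<open>1 / 2\<close> on average.\<close>
  define l where "l = real (k + 1) / real (k + 2)"
  obtain R where R: "halving_laminar R" "R \<subseteq> {0..1} \<times> {0..1}"
    "card R = Suc (card P + card Q)"
    "(\<Sum>p\<in>R. len p) = 1 + l / 2 * ((\<Sum>p\<in>P. len p) + (\<Sum>p\<in>Q. len p))"
    by (rule halving_laminar_insert_union[OF P(1,2) Q(1,2), of l]) (auto simp: l_def)
  \<comment> \<open>The difference of \<open>(k + 1) / 2\<close> and \<open>l / 2 * k\<close> is
    exactly \<open>l\<close>, which is less than 1.\<close>
  have "real (Suc k) / 2 \<le> 1 + l / 2 * real k"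
    by (simp add: l_def field_simps)
  also have "\<dots> \<le> (\<Sum>p\<in>R. len p)"
    unfolding R(4) using P(4) Q(4) by (intro add_left_mono mult_left_mono) (auto simp: l_def)
  finally have "real (Suc k) / 2 \<le> (\<Sum>p\<in>R. len p)" .
  moreover have "card R = n"
    using R(3) P(3) Q(3) m(3) by metis
  ultimately show ?case
    using R(1,2) by blast
qed

theorem theorem3p16:
  shows "\<exists>c::real. c > 0 \<and>
    (\<forall>n::nat. n \<ge> 2 \<longrightarrow>
      (\<exists>P \<subseteq> {0..1::real} \<times> {0..1::real}.
         card P = n \<and> general_position P \<and> avoids_231 (point_perm P) \<and>
         TSP P \<ge> c * ln (real n)))"
\<comment> \<open>If \<open>k\<close> is the integer part of the binary logarithm of
  \<open>n\<close>, the tour has length at least \<open>(k / 2) / 4\<close>, while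
  \<open>ln n \<le> k + 1 \<le> 2 * k\<close>; hence 1/16.\<close>
proof (intro exI[of _ "1 / 16"] conjI allI impI)
  fix n :: nat
  assume n: "n \<ge> 2"
  obtain k where k: "2 ^ k \<le> n" "n < 2 ^ (k + 1)"
    using ex_power_ivl1[of 2 n] n by auto
  then obtain P where P: "P \<subseteq> {0..1} \<times> {0..1}" "halving_laminar P" "card P = n"
    "real k / 2 \<le> (\<Sum>p\<in>P. len p)"
    using halving_laminar_exists[of k n] by auto
  have "k \<noteq> 0"
    using k n by (cases k) auto
  have "real n \<le> real (2 ^ (k + 1))"
    using k(2) by (intro of_nat_mono) simp
  then have "ln (real n) \<le> ln (2 ^ (k + 1))"
    using n by (intro ln_mono) auto
  also have "\<dots> = real (k + 1) * ln 2"
    by (rule ln_realpow)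
  also have "\<dots> \<le> real (k + 1) * 1"
    using ln_le_minus_one[of 2] by (intro mult_left_mono) auto
  also have "\<dots> \<le> 2 * real k"
    using \<open>k \<noteq> 0\<close> by simp
  finally have "1 / 16 * ln (real n) \<le> TSP P"
    using TSP_ge[OF P(2)] P(3,4) n by simp
  then show "\<exists>P \<subseteq> {0..1::real} \<times> {0..1::real}.
      card P = n \<and> general_position P \<and> avoids_231 (point_perm P) \<and>
      TSP P \<ge> 1 / 16 * ln (real n)"
    using P halving_laminar_general_position halving_laminar_avoids_231 by blast
qed simp

end
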